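(* Let $(a(n))$ be the almost Golomb sequence of order $4$. There are four sequences $\varepsilon_0,\varepsilon_1,\varepsilon_2,\varepsilon_3$ such that for all $n\ge 5$, $\varepsilon_i(n)\in\{0,1\}$ for $i=0,1,2,3$, and $$a(4n)=a(n-3)+a(n-2)+a(n-1)+a(n)+1+\varepsilon_0(n),$$ $$a(4n+1)=a(n-2)+a(n-1)+a(n)+a(n+1)+\varepsilon_1(n),$$ $$a(4n+2)=a(n-2)+a(n-1)+a(n)+a(n+1)+\varepsilon_2(n),$$ $$a(4n+3)=a(n-1)+a(n)+a(n+1)+a(n+2)-1+\varepsilon_3(n).$$ These sequences satisfy, for every $m\ge 6$, the $4$-adic recurrences $$\varepsilon_0(4m)=(1-\varepsilon_0(m))\varepsilon_0(m+1)+\varepsilon_0(m)\varepsilon_0(m-1),\quad \varepsilon_0(4m+1)=(1-\varepsilon_0(m))\varepsilon_0(m-1)+\varepsilon_0(m)\varepsilon_0(m+1),$$ $$\varepsilon_0(4m+2)=\varepsilon_0(m),\quad \varepsilon_0(4m+3)=\varepsilon_0(m+1),$$ $$\varepsilon_1(4m)=\varepsilon_2(m)\bigl(\varepsilon_1(m-1)\oplus\varepsilon_1(m+1)\bigr),\quad \varepsilon_1(4m+1)=1-\varepsilon_2(m),\quad \varepsilon_1(4m+2)=\varepsilon_1(m),\quad \varepsilon_1(4m+3)=\varepsilon_1(m+1),$$ $$\varepsilon_2(4m)=(1-\varepsilon_0(m-1))\varepsilon_1(m-1)+\varepsilon_0(m-1)(1-\varepsilon_1(m-1))\varepsilon_2(m),$$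 $$\varepsilon_2(4m+1)=\varepsilon_2(m-1),\quad \varepsilon_2(4m+2)=\varepsilon_2(m),\quad \varepsilon_2(4m+3)=1-\varepsilon_1(m),$$ $$\varepsilon_3(4m)=\varepsilon_2(m-1)\bigl(\varepsilon_2(m)\equiv\varepsilon_1(m)\bigr),\quad \varepsilon_3(4m+1)=\varepsilon_3(m-1),\quad \varepsilon_3(4m+2)=\varepsilon_3(m),$$ $$\varepsilon_3(4m+3)=(1-\varepsilon_1(m+1))\bigl(\varepsilon_2(m)\equiv\varepsilon_1(m)\bigr).$$ In particular, each $\varepsilon_i$ is $4$-automatic, and $(a(n))$ is $4$-regular.
   Context: Consider nondecreasing sequences of positive integers $(a(n))_{n\ge 1}$, extended by $a(k)=0$ for $k\le 0$, such that (1) $a\bigl(a(n)+a(n-1)+a(n-2)+a(n-3)\bigr)=n$ for every $n\ge 1$; and (2) for every $n\ge 2$, no integer $m$ with $a(n-1)\le m<a(n)$ satisfies $a\bigl(m+a(n-1)+a(n-2)+a(n-3)\bigr)=n$. The almost Golomb sequence of order $4$ is the earliest such sequence, i.e. the lexicographically smallest among the sequences satisfying (1) and (2). It begins $1,2,2,2,3,3,4,4,5,6,6,7,7,8,8,9,9,9,10,10,11,11,11,12,\ldots$ For bits $x,y\in\{0,1\}$: $x\oplus y:=x+y-2xy$ (XOR) and $(x\equiv y):=1-x-y+2xy$ (XNOR). The $4$-kernel of $(f(n))_{n\ge0}$ is $\{(f(4^i n+j))_{n\ge 0}: i\ge 0,\ 0\le j<4^i\}$. A sequence with values in a finite set is $4$-automatic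 if its $4$-kernel is finite; an integer-valued sequence is $4$-regular if the $\mathbb{Z}$-module spanned by its $4$-kernel is finitely generated. The values $\varepsilon_i(n)$ for $0\le n<5$ are irrelevant and may be set to $0$ (changing finitely many terms does not affect automaticity).
   Formalization: Condition (2) in the definition of the almost Golomb sequence is imposed for n ≥ 3 instead of n ≥ 2, since with (1) forcing a(1)=1 and a(2)=2 the instance n=2, m=1 gives a(2)=2 and so excludes every sequence, including the listed one. *)

theory Defs
  imports Complex_Main "HOL-Library.Function_Algebras"
begin

definition golomb4_base :: "(int \<Rightarrow> int) \<Rightarrow> bool" where
  "golomb4_base a \<longleftrightarrow>
     (\<forall>k\<le>0. a k = 0) \<and>
     (\<forall>n\<ge>1. 0 < a n) \<and>
     (\<forall>n\<ge>1. a n \<le> a (n + 1)) \<and>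
     (\<forall>n\<ge>1. a (a n + a (n - 1) + a (n - 2) + a (n - 3)) = n)"

text \<open>
  The first-occurrence condition: for every \<open>n\<close>, no \<open>m\<close> with \<open>a (n - 1) \<le> m < a n\<close> satisfies
  \<open>a (m + a (n - 1) + a (n - 2) + a (n - 3)) = n\<close>.
  Its customary range is \<open>n \<ge> 2\<close>, but the instance \<open>n = 2\<close> is degenerate: with \<open>a 1 = 1\<close> and
  \<open>m = 1\<close> it requires \<open>a (1 + a 1) \<noteq> 2\<close>, which is a condition on the term \<open>a 2\<close> itself.
  Read literally it excludes every sequence (\<open>no_sequence_if_from_2\<close> below), in particular
  \<open>1, 2, 2, 2, 3, 3, 4, 4, 5, \<dots>\<close>; it is therefore imposed for \<open>n \<ge> 3\<close>.
\<close>

definition golomb4_minimal_from :: "int \<Rightarrow> (int \<Rightarrow> int) \<Rightarrow> bool" where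
  "golomb4_minimal_from N a \<longleftrightarrow>
     (\<forall>n\<ge>N. \<not> (\<exists>m. a (n - 1) \<le> m \<and> m < a n \<and>
        a (m + a (n - 1) + a (n - 2) + a (n - 3)) = n))"

lemma no_sequence_if_from_2: "\<not> (golomb4_base a \<and> golomb4_minimal_from 2 a)"
proof
  assume "golomb4_base a \<and> golomb4_minimal_from 2 a"
  then have base: "golomb4_base a" and mini: "golomb4_minimal_from 2 a" by auto
  have zero: "a k = 0" if "k \<le> 0" for k using base that by (simp add: golomb4_base_def)
  have pos: "0 < a n" if "1 \<le> n" for n using base that by (simp add: golomb4_base_def)
  have step_le: "a n \<le> a (n + 1)" if "1 \<le> n" for n using base that by (simp add: golomb4_base_def)
  have rec: "a (a n + a (n - 1) + a (n - 2) + a (n - 3)) = n" if "1 \<le> n" for n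
    using base that by (simp add: golomb4_base_def)
  have mono: "a i \<le> a j" if "1 \<le> i" "i \<le> j" for i j
    using that(2)
  proof (induction j rule: int_ge_induct)
    case base
    show ?case by simp
  next
    case (step j)
    then show ?case using \<open>1 \<le> i\<close> step_le[of j] by linarith
  qed
  have r1: "a (a 1) = 1" using rec[of 1] by (simp add: zero)
  have a1: "a 1 = 1" using mono[of 1 "a 1"] pos[of 1] r1 by simp
  have r2: "a (a 2 + 1) = 2" using rec[of 2] by (simp add: zero a1)
  have "a 2 \<noteq> 1" using r2 by auto
  then have ge2: "2 \<le> a 2" using mono[of 1 2] a1 by simp
  have "\<not> (a 1 \<le> 1 \<and> 1 < a 2 \<and> a (1 + a 1 + a 0 + a (-1)) = 2)"
    using mini[unfolded golomb4_minimal_from_def, rule_format, of 2] by auto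
  then have "a 2 \<noteq> 2" using a1 ge2 by (simp add: zero)
  moreover have "a 2 \<le> 2" using mono[of 2 "a 2 + 1"] ge2 r2 by simp
  ultimately show False using ge2 by simp
qed

definition golomb4_admissible :: "(int \<Rightarrow> int) \<Rightarrow> bool" where
  "golomb4_admissible a \<longleftrightarrow> golomb4_base a \<and> golomb4_minimal_from 3 a"

definition lex_less :: "(int \<Rightarrow> int) \<Rightarrow> (int \<Rightarrow> int) \<Rightarrow> bool" where
  "lex_less a b \<longleftrightarrow> (\<exists>n\<ge>1. a n < b n \<and> (\<forall>k. 1 \<le> k \<and> k < n \<longrightarrow> a k = b k))"

definition almost_golomb4 :: "int \<Rightarrow> int" where
  "almost_golomb4 = (THE a. golomb4_admissible a \<and>
     (\<forall>b. golomb4_admissible b \<longrightarrow> a = b \<or> lex_less a b))"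

definition bit_xor :: "int \<Rightarrow> int \<Rightarrow> int" where
  "bit_xor x y = x + y - 2 * x * y"

definition bit_xnor :: "int \<Rightarrow> int \<Rightarrow> int" where
  "bit_xnor x y = 1 - x - y + 2 * x * y"

definition kernel_seqs :: "nat \<Rightarrow> (nat \<Rightarrow> 'a) \<Rightarrow> (nat \<Rightarrow> 'a) set" where
  "kernel_seqs k f = {g. \<exists>i j. j < k ^ i \<and> g = (\<lambda>n. f (k ^ i * n + j))}"

definition automatic_seq :: "nat \<Rightarrow> (nat \<Rightarrow> 'a) \<Rightarrow> bool" where
  "automatic_seq k f \<longleftrightarrow> finite (range f) \<and> finite (kernel_seqs k f)"

text \<open>
  The \<open>\<int>\<close>-module of all integer sequences; \<open>int_seq.span\<close> is the submodule generated by a set.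
\<close>

interpretation int_seq: module "\<lambda>(c::int) (f::nat \<Rightarrow> int) n. c * f n"
  by unfold_locales (auto simp: fun_eq_iff algebra_simps)

definition regular_seq :: "nat \<Rightarrow> (nat \<Rightarrow> int) \<Rightarrow> bool" where
  "regular_seq k f \<longleftrightarrow> (\<exists>G. finite G \<and> int_seq.span G = int_seq.span (kernel_seqs k f))"

end

theory Submission
  imports Defs "HOL-Library.FuncSet"
begin

text \<open>
  Write \<open>s k = a k + a (k - 1) + a (k - 2) + a (k - 3)\<close>. Condition (1) puts the value \<open>k\<close> at
  place \<open>s k\<close>, and in the least sequence \<open>k\<close> first occurs there for \<open>k \<ge> 3\<close>, so that it occupies
  exactly the places \<open>s k, \<dots>, s (k + 1) - 1\<close>. The sequence \<open>greedy\<close> is built to have this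
  property: after the first terms it is raised only at a place \<open>s k\<close>. This is consistent because its steps are \<open>0\<close> or \<open>1\<close>.
  The run of the value \<open>v\<close> has length \<open>s (v + 1) - s v = a (v + 1) - a (v - 3) \<le> 4\<close>, and an empty
  run would need some value to be repeated five times. An admissible sequence that agrees with
  \<open>greedy\<close> before a place \<open>s k\<close> has the same \<open>s k\<close> and therefore must reach \<open>k\<close> there too,
  so \<open>greedy\<close> is the lexicographically least one (\<open>almost_golomb4_eq_greedy\<close>).

  The \<open>4\<close>-adic structure comes from evaluating \<open>s\<close> near the places \<open>s n\<close>. The values of \<open>a\<close> there
  are \<open>n - 1\<close>, \<open>n\<close>, \<open>n + 1\<close> up to small errors, hence \<open>s (s n + y)\<close> is \<open>4 n\<close> plus a small number, and
  comparing it with \<open>4 n + i\<close> determines \<open>a (4 n + i)\<close>. As long as runs have length at most \<open>3\<close>,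
  the outcome depends only on whether \<open>n\<close> and \<open>n + 1\<close> are \<^emph>\<open>single\<close>, that is, occur exactly once in
  the sequence. This expresses all four correction sequences by the one bit sequence \<open>single\<close>.
  Subtracting such values gives the run lengths at \<open>4 n + i\<close> from those at \<open>n - 1\<close>, \<open>n\<close>, \<open>n + 1\<close>
  (\<open>run_4n\<close>), and by induction the runs of all values \<open>n \<ge> 3\<close> have length \<open>1\<close>, \<open>2\<close> or \<open>3\<close>, neighbours
  differing by at most one (\<open>tame_runs\<close>). From there one reads off the recurrences of \<open>single\<close>
  (\<open>single_4n\<close>), deduces that no three consecutive numbers are single, and the sixteen recurrences
  become identities between bits (\<open>eps_4n\<close>).

  Finally the differences \<open>a (n + t) - a n\<close> with \<open>-4 \<le> t \<le> 3\<close> take finitely many values, and for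
  \<open>n \<ge> 6\<close> those at \<open>4 n + j\<close> are a function of those at \<open>n\<close>; they are the state of an automaton that
  computes the corrections. Moreover \<open>a (4 n + j) - 4 a n\<close> depends on this state only, so
  up to finitely many terms every element of the \<open>4\<close>-kernel of \<open>a\<close> is a multiple of \<open>a\<close> plus
  a function of the state. These sequences generate a finitely generated \<open>\<int>\<close>-module, and
  its submodules are finitely generated as well.
\<close>

section \<open>The greedy sequence\<close>

text \<open>
  The places up to \<open>n + 4\<close> of \<open>greedy_prefix n\<close> are final; the value \<open>2\<close> beyond them is a placeholder
  that later steps overwrite. Place \<open>n + 5\<close> gets the next value \<open>v + 1\<close> exactly when it is
  the place where that value has to appear.
\<close>

primrec greedy_prefix :: "nat \<Rightarrow> int \<Rightarrow> int" where
  "greedy_prefix 0 = (\<lambda>k. if k \<le> 0 then 0 else if k = 1 then 1 else 2)"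
| "greedy_prefix (Suc n) =
     (let f = greedy_prefix n; v = f (int n + 4) in
      f (int n + 5 := if f (v + 1) + f v + f (v - 1) + f (v - 2) = int n + 5 then v + 1 else v))"

definition greedy :: "int \<Rightarrow> int" where
  "greedy k = greedy_prefix (nat (k - 4)) k"

text \<open>For \<open>k \<ge> 3\<close> this is the first place that holds the value \<open>k\<close>; see \<open>greedy_eqI\<close>.\<close>

definition start :: "int \<Rightarrow> int" where
  "start k = greedy k + greedy (k - 1) + greedy (k - 2) + greedy (k - 3)"

definition run :: "int \<Rightarrow> int" where
  "run k = start (k + 1) - start k"

lemma run_eq: "run k = greedy (k + 1) - greedy (k - 3)"
  by (simp add: run_def start_def algebra_simps)

lemma start_shift:
  "start (k - 1) = greedy (k - 1) + greedy (k - 2) + greedy (k - 3) + greedy (k - 4)"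
  "start (k + 1) = greedy (k + 1) + greedy k + greedy (k - 1) + greedy (k - 2)"
  "start (k + 2) = greedy (k + 2) + greedy (k + 1) + greedy k + greedy (k - 1)"
  "start (k + 3) = greedy (k + 3) + greedy (k + 2) + greedy (k + 1) + greedy k"
  by (simp_all add: start_def algebra_simps)

lemma greedy_prefix_eq: "k \<le> int n + 4 \<Longrightarrow> greedy_prefix n k = greedy k"
proof (induction n)
  case 0
  then show ?case by (simp add: greedy_def)
next
  case (Suc n)
  show ?case
  proof (cases "k = int n + 5")
    case True
    then have "nat (k - 4) = Suc n" by simp
    then show ?thesis by (simp add: greedy_def)
  next
    case False
    then show ?thesis using Suc by (simp add: Let_def)
  qed
qed

lemma greedy_initial:
  "k \<le> 0 \<Longrightarrow> greedy k = 0" "greedy 1 = 1" "greedy 2 = 2" "greedy 3 = 2" "greedy 4 = 2"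
  by (simp_all add: greedy_def)

lemma greedy_Suc_aux:
  assumes "4 \<le> n" "greedy n + 1 \<le> n"
  shows "greedy (n + 1) = (if start (greedy n + 1) = n + 1 then greedy n + 1 else greedy n)"
proof -
  define m where "m = nat (n - 4)"
  have n: "n = int m + 4" using assms(1) by (simp add: m_def)
  have "greedy (n + 1) = greedy_prefix (Suc m) (n + 1)"
    by (rule greedy_prefix_eq[symmetric]) (simp add: n)
  also have "\<dots> = (if start (greedy n + 1) = n + 1 then greedy n + 1 else greedy n)"
    using assms(2) by (simp add: Let_def n start_def greedy_prefix_eq algebra_simps)
  finally show ?thesis .
qed

lemma greedy_less:
  assumes "3 \<le> n" shows "greedy n + 1 \<le> n"
  using assms
proof (induction n rule: int_ge_induct)
  case base
  show ?case by (simp add: greedy_initial)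
next
  case (step n)
  show ?case
  proof (cases "n = 3")
    case True
    then show ?thesis by (simp add: greedy_initial)
  next
    case False
    then show ?thesis using step greedy_Suc_aux[of n] by (simp split: if_splits)
  qed
qed

lemma greedy_Suc:
  assumes "4 \<le> n"
  shows "greedy (n + 1) = (if start (greedy n + 1) = n + 1 then greedy n + 1 else greedy n)"
  using greedy_Suc_aux[of n] greedy_less[of n] assms by simp

text \<open>
  The recurrences are available for \<open>m \<ge> 6\<close>, so the inductions over \<open>m \<mapsto> 4 m + i\<close> start with the
  indices below \<open>24\<close>.
\<close>

lemma greedy_values:
  "greedy 5 = 3" "greedy 6 = 3" "greedy 7 = 4" "greedy 8 = 4" "greedy 9 = 5"
  "greedy 10 = 6" "greedy 11 = 6" "greedy 12 = 7" "greedy 13 = 7" "greedy 14 = 8"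
  "greedy 15 = 8" "greedy 16 = 9" "greedy 17 = 9" "greedy 18 = 9" "greedy 19 = 10"
  "greedy 20 = 10" "greedy 21 = 11" "greedy 22 = 11" "greedy 23 = 11" "greedy 24 = 12"
  "greedy 25 = 12"
proof -
  note defs = greedy_initial start_def
  show 5: "greedy 5 = 3" using greedy_Suc[of 4] by (simp add: defs)
  show 6: "greedy 6 = 3" using greedy_Suc[of 5] by (simp add: defs 5)
  show 7: "greedy 7 = 4" using greedy_Suc[of 6] by (simp add: defs 5 6)
  show 8: "greedy 8 = 4" using greedy_Suc[of 7] by (simp add: defs 5 6 7)
  show 9: "greedy 9 = 5" using greedy_Suc[of 8] by (simp add: defs 5 6 7 8)
  note defs = defs 5 6 7 8 9
  show 10: "greedy 10 = 6" using greedy_Suc[of 9] by (simp add: defs)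
  show 11: "greedy 11 = 6" using greedy_Suc[of 10] by (simp add: defs 10)
  show 12: "greedy 12 = 7" using greedy_Suc[of 11] by (simp add: defs 10 11)
  show 13: "greedy 13 = 7" using greedy_Suc[of 12] by (simp add: defs 10 11 12)
  note defs = defs 10 11 12 13
  show 14: "greedy 14 = 8" using greedy_Suc[of 13] by (simp add: defs)
  show 15: "greedy 15 = 8" using greedy_Suc[of 14] by (simp add: defs 14)
  show 16: "greedy 16 = 9" using greedy_Suc[of 15] by (simp add: defs 14 15)
  show 17: "greedy 17 = 9" using greedy_Suc[of 16] by (simp add: defs 14 15 16)
  show 18: "greedy 18 = 9" using greedy_Suc[of 17] by (simp add: defs 17)
  show 19: "greedy 19 = 10" using greedy_Suc[of 18] by (simp add: defs 18)
  show 20: "greedy 20 = 10" using greedy_Suc[of 19] by (simp add: defs 19)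
  show 21: "greedy 21 = 11" using greedy_Suc[of 20] by (simp add: defs 20)
  show 22: "greedy 22 = 11" using greedy_Suc[of 21] by (simp add: defs 21)
  show 23: "greedy 23 = 11" using greedy_Suc[of 22] by (simp add: defs 22)
  show 24: "greedy 24 = 12" using greedy_Suc[of 23] by (simp add: defs 23)
  show "greedy 25 = 12" using greedy_Suc[of 24] by (simp add: defs 24)
qed

lemma greedy_increment: "greedy n \<le> greedy (n + 1) \<and> greedy (n + 1) \<le> greedy n + 1"
proof -
  consider "n < 0" | "n = 0" | "n = 1" | "n = 2" | "n = 3" | "4 \<le> n" by linarith
  then show ?thesis by cases (use greedy_Suc[of n] in \<open>simp_all add: greedy_initial\<close>)
qed

lemma greedy_add: "0 \<le> k \<Longrightarrow> greedy n \<le> greedy (n + k) \<and> greedy (n + k) \<le> greedy n + k"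
proof (induction k rule: int_ge_induct)
  case (step k)
  then show ?case using greedy_increment[of "n + k"] by (simp add: add.assoc)
qed simp

lemma greedy_mono: "m \<le> n \<Longrightarrow> greedy m \<le> greedy n"
  using greedy_add[of "n - m" m] by simp

lemma start_mono: "m \<le> n \<Longrightarrow> start m \<le> start n"
  unfolding start_def by (intro add_mono greedy_mono) auto

lemma run_le_4: "run k \<le> 4"
  using greedy_add[of 4 "k - 3"] by (simp add: run_eq algebra_simps)

text \<open>
  When the sequence is raised to \<open>v + 1\<close> at \<open>n\<close>, the claim for \<open>n\<close> says that the run of \<open>v + 1\<close> is
  not empty, i.e. \<open>greedy (v - 2) < greedy (v + 2)\<close>. For \<open>v \<ge> 7\<close> some value would otherwise fill five
  places, all of them before \<open>n\<close>, and by the induction hypothesis its run would be longer than \<open>4\<close>.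
\<close>

lemma start_greedy:
  assumes "5 \<le> n"
  shows "start (greedy n) \<le> n \<and> n < start (greedy n + 1)"
  using assms
proof (induction "nat n" arbitrary: n rule: less_induct)
  case less
  show ?case
  proof (cases "n = 5")
    case True
    then show ?thesis by (simp add: start_def greedy_initial greedy_values)
  next
    case False
    define m where "m = n - 1"
    define v where "v = greedy m"
    have m: "5 \<le> m" and n: "n = m + 1" using less.prems False by (auto simp: m_def)
    have IH: "start v \<le> m" "m < start (v + 1)"
      using less.hyps[of m] m by (auto simp: n v_def)
    have v: "3 \<le> v" using greedy_mono[OF m] by (simp add: greedy_values v_def)
    show ?thesis
    proof (cases "start (v + 1) = n")
      case False
      then have "greedy n = v" using greedy_Suc[of m] m by (simp add: n v_def)
      then show ?thesis using IH False by (simp add: n)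
    next
      case True
      then have gn: "greedy n = v + 1" using greedy_Suc[of m] m by (simp add: n v_def)
      have "greedy (v - 2) < greedy (v + 2)"
      proof (cases "7 \<le> v")
        case True
        have vm: "v + 2 < n"
          using greedy_add[of "m - 5" 5] m by (simp add: n v_def greedy_values)
        have le: "greedy (v - 2) \<le> greedy (v + 2)" by (rule greedy_mono) simp
        moreover have "greedy (v - 2) \<noteq> greedy (v + 2)"
        proof
          assume eq: "greedy (v - 2) = greedy (v + 2)"
          have "start (greedy (v - 2)) \<le> v - 2" "v + 2 < start (greedy (v + 2) + 1)"
            using less.hyps[of "v - 2"] less.hyps[of "v + 2"] vm True by auto
          then have "run (greedy (v + 2)) > 4" using eq by (simp add: run_def)
          then show False using run_le_4[of "greedy (v + 2)"] by simp
        qed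
        ultimately show ?thesis by simp
      next
        case False
        then have "v = 3 \<or> v = 4 \<or> v = 5 \<or> v = 6" using v by auto
        then show ?thesis by (auto simp: greedy_initial greedy_values)
      qed
      then have "n < start (v + 2)"
        using True run_eq[of "v + 1"] by (simp add: run_def algebra_simps)
      then show ?thesis using gn True by (simp add: add.assoc)
    qed
  qed
qed

lemma greedy_two_below: "5 \<le> n \<Longrightarrow> greedy n + 2 \<le> n"
  using greedy_add[of "n - 5" 5] by (simp add: greedy_values)

lemma run_pos:
  assumes "3 \<le> k" shows "1 \<le> run k"
proof (cases "8 \<le> k")
  case True
  have "greedy (k - 3) \<noteq> greedy (k + 1)"
  proof
    assume eq: "greedy (k - 3) = greedy (k + 1)"
    have "start (greedy (k - 3)) \<le> k - 3" "k + 1 < start (greedy (k + 1) + 1)"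
      using start_greedy[of "k - 3"] start_greedy[of "k + 1"] True by auto
    then have "run (greedy (k + 1)) > 4" using eq by (simp add: run_def)
    then show False using run_le_4[of "greedy (k + 1)"] by simp
  qed
  moreover have "greedy (k - 3) \<le> greedy (k + 1)" by (rule greedy_mono) simp
  ultimately show ?thesis by (simp add: run_eq)
next
  case False
  then have "k = 3 \<or> k = 4 \<or> k = 5 \<or> k = 6 \<or> k = 7" using assms by auto
  then show ?thesis by (auto simp: run_eq greedy_initial greedy_values)
qed

lemma start_less:
  assumes "3 \<le> j" "j < k" shows "start j < start k"
proof -
  have "start j < start (j + 1)" using run_pos[OF assms(1)] by (simp add: run_def)
  also have "\<dots> \<le> start k" using assms(2) by (intro start_mono) simp
  finally show ?thesis .
qed

lemma start_ge_5: "3 \<le> k \<Longrightarrow> 5 \<le> start k"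
  using start_mono[of 3 k] by (simp add: start_def greedy_initial)

lemma greedy_eqI:
  assumes "3 \<le> k" "start k \<le> n" "n < start (k + 1)"
  shows "greedy n = k"
proof -
  have n: "5 \<le> n" using start_ge_5[OF assms(1)] assms(2) by simp
  note sg = start_greedy[OF n]
  have "3 \<le> greedy n" using greedy_mono[OF n] by (simp add: greedy_values)
  then have "\<not> k < greedy n" "\<not> greedy n < k"
    using sg assms start_mono[of "k + 1" "greedy n"] start_mono[of "greedy n + 1" k] by auto
  then show ?thesis by simp
qed

lemma greedy_start: "3 \<le> k \<Longrightarrow> greedy (start k) = k"
  using greedy_eqI[of k "start k"] start_less[of k "k + 1"] by simp

lemma greedy_before_start:
  assumes "3 \<le> k" shows "greedy (start k - 1) = k - 1"
proof (cases "k = 3")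
  case True
  then show ?thesis by (simp add: start_def greedy_initial)
next
  case False
  then show ?thesis using greedy_eqI[of "k - 1" "start k - 1"] start_less[of "k - 1" k] assms by simp
qed

section \<open>The greedy sequence is the lexicographically least one\<close>

lemma greedy_admissible: "golomb4_admissible greedy"
  unfolding golomb4_admissible_def
proof
  show "golomb4_base greedy"
    unfolding golomb4_base_def
  proof (intro conjI allI impI)
    fix n :: int assume n: "1 \<le> n"
    show "0 < greedy n" using greedy_mono[OF n] by (simp add: greedy_initial)
    show "greedy n \<le> greedy (n + 1)" by (rule greedy_mono) simp
    consider "n = 1" | "n = 2" | "3 \<le> n" using n by linarith
    then show "greedy (greedy n + greedy (n - 1) + greedy (n - 2) + greedy (n - 3)) = n"
      by cases (use greedy_start[of n] in \<open>simp_all add: greedy_initial start_def\<close>)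
  qed (simp add: greedy_initial)
  show "golomb4_minimal_from 3 greedy"
    unfolding golomb4_minimal_from_def
  proof (intro allI impI notI)
    fix n :: int assume n: "3 \<le> n"
    assume "\<exists>m. greedy (n - 1) \<le> m \<and> m < greedy n \<and>
      greedy (m + greedy (n - 1) + greedy (n - 2) + greedy (n - 3)) = n"
    then obtain m where m: "greedy (n - 1) \<le> m" "m < greedy n"
      "greedy (m + greedy (n - 1) + greedy (n - 2) + greedy (n - 3)) = n" by blast
    then have "m = greedy n - 1" using greedy_increment[of "n - 1"] by simp
    then have "m + greedy (n - 1) + greedy (n - 2) + greedy (n - 3) = start n - 1"
      by (simp add: start_def)
    then show False using m(3) greedy_before_start[OF n] by simp
  qed
qed

text \<open>
  At the first difference an admissible \<open>b\<close> could be smaller only by missing a step of \<open>greedy\<close> to a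
  value \<open>k\<close>. For \<open>k \<ge> 3\<close> that step is taken at \<open>start k\<close>, a place computed from terms on which both
  agree, and there \<open>b\<close> has the value \<open>k\<close> by its defining equation. For \<open>k = 2\<close> the equation at
  \<open>2\<close> excludes \<open>b 2 = 1\<close>.
\<close>

lemma greedy_least:
  assumes "golomb4_admissible b"
  shows "greedy = b \<or> lex_less greedy b"
proof (cases "greedy = b")
  case False
  have b0: "b k = 0" if "k \<le> 0" for k
    using assms that by (simp add: golomb4_admissible_def golomb4_base_def)
  have bpos: "0 < b n" if "1 \<le> n" for n
    using assms that by (simp add: golomb4_admissible_def golomb4_base_def)
  have bstep: "b n \<le> b (n + 1)" if "1 \<le> n" for n
    using assms that by (simp add: golomb4_admissible_def golomb4_base_def)
  have brec: "b (b n + b (n - 1) + b (n - 2) + b (n - 3)) = n" if "1 \<le> n" for n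
    using assms that by (simp add: golomb4_admissible_def golomb4_base_def)
  obtain k where k: "greedy k \<noteq> b k" using False by auto
  have k1: "1 \<le> k" using k b0[of k] greedy_initial(1)[of k] by force
  \<comment> \<open>Let \<open>n\<close> be the first place where the two sequences differ.\<close>
  define p where "p = (LEAST p. greedy (int p) \<noteq> b (int p))"
  define n where "n = int p"
  have "greedy (int (nat k)) \<noteq> b (int (nat k))" using k k1 by simp
  then have neq: "greedy n \<noteq> b n" unfolding n_def p_def by (rule LeastI)
  have below: "greedy j = b j" if "j < n" for j
  proof (cases "j \<le> 0")
    case False
    then have "nat j < p" using that by (simp add: n_def)
    then have "greedy (int (nat j)) = b (int (nat j))" using not_less_Least p_def by blast
    then show ?thesis using False by simp
  qed (simp add: b0 greedy_initial)
  have n1: "1 \<le> n" using neq b0[of n] greedy_initial(1)[of n] by force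
  have "\<not> b n < greedy n"
  proof
    assume less: "b n < greedy n"
    have n2: "2 \<le> n" using less bpos[of 1] n1 by (cases "n = 1") (auto simp: greedy_initial)
    have "greedy (n - 1) \<le> b n" using bstep[of "n - 1"] below[of "n - 1"] n2 by simp
    then have jump: "greedy n = greedy (n - 1) + 1" and bn: "b n = greedy (n - 1)"
      using less greedy_increment[of "n - 1"] by auto
    consider "n = 2" | "n = 3" | "n = 4" | "5 \<le> n" using n2 by linarith
    then show False
    proof cases
      case 1
      then have "b 2 = 1" using bn by (simp add: greedy_initial)
      moreover have "b 1 = 1" using below[of 1] 1 by (simp add: greedy_initial)
      ultimately show False using brec[of 2] by (simp add: b0)
    next
      case 4
      have first: "start (greedy n) = n"
      proof (cases "n = 5")
        case False
        then show ?thesis using start_greedy[of n] start_greedy[of "n - 1"] 4 jump by auto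
      qed (simp add: start_def greedy_values greedy_initial)
      have gn: "greedy n + 2 \<le> n" by (rule greedy_two_below[OF 4])
      have "1 \<le> greedy n" using greedy_mono[of 1 n] 4 by (simp add: greedy_initial)
      then have "b (start (greedy n)) = greedy n"
        using brec[of "greedy n"] gn by (simp add: start_def below)
      then show False using first less by simp
    qed (use jump in \<open>simp_all add: greedy_initial\<close>)
  qed
  then have "lex_less greedy b" unfolding lex_less_def using neq n1 below by force
  then show ?thesis ..
qed simp

lemma lex_less_asym: "lex_less a b \<Longrightarrow> \<not> lex_less b a"
proof
  assume "lex_less a b" "lex_less b a"
  then obtain m n where "1 \<le> m" "a m < b m" "\<forall>k. 1 \<le> k \<and> k < m \<longrightarrow> a k = b k"
    and "1 \<le> n" "b n < a n" "\<forall>k. 1 \<le> k \<and> k < n \<longrightarrow> b k = a k"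
    unfolding lex_less_def by blast
  then show False by (cases m n rule: linorder_cases) auto
qed

lemma almost_golomb4_eq_greedy: "almost_golomb4 = greedy"
  unfolding almost_golomb4_def
proof (rule the_equality)
  show "golomb4_admissible greedy \<and> (\<forall>b. golomb4_admissible b \<longrightarrow> greedy = b \<or> lex_less greedy b)"
    using greedy_admissible greedy_least by blast
next
  fix a assume "golomb4_admissible a \<and> (\<forall>b. golomb4_admissible b \<longrightarrow> a = b \<or> lex_less a b)"
  then show "a = greedy" using greedy_admissible greedy_least lex_less_asym by blast
qed

section \<open>Values at multiples of four\<close>

text \<open>A number is single if it is the value of exactly one term.\<close>

definition single :: "int \<Rightarrow> int" where
  "single n = of_bool (run n = 1)"

text \<open>
  The corrections of the theorem, as the evaluation of \<open>greedy\<close> at \<open>4 n + i\<close> below produces them.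
\<close>

definition eps0 :: "int \<Rightarrow> int" where "eps0 n = 1 - single n"
definition eps1 :: "int \<Rightarrow> int" where "eps1 n = single n * (1 - single (n + 1))"
definition eps2 :: "int \<Rightarrow> int" where "eps2 n = 1 - (1 - single n) * single (n + 1)"
definition eps3 :: "int \<Rightarrow> int" where "eps3 n = single (n + 1)"

lemmas eps_defs = eps0_def eps1_def eps2_def eps3_def

lemma single_cases: "single n = 0 \<or> single n = 1"
  by (simp add: single_def)

lemma greedy_after_start:
  assumes "3 \<le> n" shows "greedy (start n + 1) = n + single n"
proof (cases "run n = 1")
  case True
  then have "start n + 1 = start (n + 1)" by (simp add: run_def)
  then show ?thesis using greedy_start[of "n + 1"] assms True by (simp add: single_def)
next
  case False
  then have "start n + 1 < start (n + 1)" using run_pos[OF assms] by (simp add: run_def)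
  then show ?thesis using greedy_eqI[of n "start n + 1"] assms False by (simp add: single_def)
qed

lemma greedy_two_before_start:
  assumes "4 \<le> n" shows "greedy (start n - 2) = n - 1 - single (n - 1)"
proof (cases "run (n - 1) = 1")
  case True
  then have "start n - 2 = start (n - 1) - 1" by (simp add: run_def)
  then show ?thesis using greedy_before_start[of "n - 1"] assms True by (simp add: single_def)
next
  case False
  then have "start (n - 1) \<le> start n - 2" using run_pos[of "n - 1"] assms by (simp add: run_def)
  then show ?thesis using greedy_eqI[of "n - 1" "start n - 2"] assms False by (simp add: single_def)
qed

text \<open>
  In the three lemmas below \<open>greedy_eqI\<close> reduces an equation \<open>greedy (4 * n + i) = k\<close> to
  \<open>start k \<le> 4 * n + i < start (k + 1)\<close>. Here \<open>k\<close> is close to \<open>start n\<close>, \<open>start (n + 1)\<close> or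
  \<open>start (n + 2)\<close>, and the terms summed in \<open>start k\<close> are known there from the ends of the runs.
  The bound \<open>3\<close> on a run length limits how long the sequence stays constant next to these places.
\<close>

lemma greedy_4n:
  assumes "5 \<le> n" "run n \<le> 3"
  shows "greedy (4 * n) = start n + 1 + eps0 n"
proof -
  let ?q = "start n"
  have q: "5 \<le> ?q" using start_ge_5 assms by simp
  have v: "greedy ?q = n" "greedy (?q - 1) = n - 1" "greedy (?q - 2) = n - 1 - single (n - 1)"
    "greedy (?q + 1) = n + single n"
    using greedy_start[of n] greedy_before_start[of n] greedy_two_before_start[of n]
      greedy_after_start[of n] assms by simp_all
  have m: "greedy (?q + 1) \<le> greedy (?q + 2)" "greedy (?q + 2) \<le> greedy (?q + 3)"
    "greedy (?q + 2) \<le> greedy (?q + 1) + 1"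
    using greedy_increment[of "?q + 1"] greedy_increment[of "?q + 2"] by (simp_all add: add.assoc)
  have "greedy (start (n + 1)) \<le> greedy (?q + 3)"
    using assms(2) by (intro greedy_mono) (simp add: run_def)
  then have m3: "n + 1 \<le> greedy (?q + 3)" using greedy_start[of "n + 1"] assms(1) by simp
  have s: "start (?q + 1) = greedy (?q + 1) + greedy ?q + greedy (?q - 1) + greedy (?q - 2)"
    "start (?q + 2) = greedy (?q + 2) + greedy (?q + 1) + greedy ?q + greedy (?q - 1)"
    "start (?q + 3) = greedy (?q + 3) + greedy (?q + 2) + greedy (?q + 1) + greedy ?q"
    by (rule start_shift start_def)+
  show ?thesis
  proof (rule greedy_eqI)
    show "3 \<le> ?q + 1 + eps0 n" using q single_cases[of n] by (auto simp: eps0_def)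
    show "start (?q + 1 + eps0 n) \<le> 4 * n" "4 * n < start (?q + 1 + eps0 n + 1)"
      using single_cases[of n] single_cases[of "n - 1"] s v m m3
      by (auto simp: eps0_def add.assoc)
  qed
qed

lemma greedy_4n_1_2:
  assumes "5 \<le> n"
  shows "greedy (4 * n + 1) = start (n + 1) + eps1 n"
    and "greedy (4 * n + 2) = start (n + 1) + eps2 n"
proof -
  let ?p = "start (n + 1)"
  have p: "5 \<le> ?p" using start_ge_5 assms by simp
  have v: "greedy ?p = n + 1" "greedy (?p - 1) = n" "greedy (?p - 2) = n - single n"
    "greedy (?p + 1) = n + 1 + single (n + 1)"
    using greedy_start[of "n + 1"] greedy_before_start[of "n + 1"] greedy_two_before_start[of "n + 1"]
      greedy_after_start[of "n + 1"] assms by simp_all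
  have m: "greedy (?p + 1) \<le> greedy (?p + 2)" "greedy (?p - 3) \<le> greedy (?p - 2)"
    by (intro greedy_mono; simp)+
  have s: "start ?p = greedy ?p + greedy (?p - 1) + greedy (?p - 2) + greedy (?p - 3)"
    "start (?p + 1) = greedy (?p + 1) + greedy ?p + greedy (?p - 1) + greedy (?p - 2)"
    "start (?p + 2) = greedy (?p + 2) + greedy (?p + 1) + greedy ?p + greedy (?p - 1)"
    by (rule start_shift start_def)+
  show "greedy (4 * n + 1) = ?p + eps1 n"
  proof (rule greedy_eqI)
    show "3 \<le> ?p + eps1 n"
      using p single_cases[of n] single_cases[of "n + 1"] by (auto simp: eps1_def)
    show "start (?p + eps1 n) \<le> 4 * n + 1" "4 * n + 1 < start (?p + eps1 n + 1)"
      using single_cases[of n] single_cases[of "n + 1"] s v m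
      by (auto simp: eps1_def add.assoc)
  qed
  show "greedy (4 * n + 2) = ?p + eps2 n"
  proof (rule greedy_eqI)
    show "3 \<le> ?p + eps2 n"
      using p single_cases[of n] single_cases[of "n + 1"] by (auto simp: eps2_def)
    show "start (?p + eps2 n) \<le> 4 * n + 2" "4 * n + 2 < start (?p + eps2 n + 1)"
      using single_cases[of n] single_cases[of "n + 1"] s v m
      by (auto simp: eps2_def add.assoc)
  qed
qed

lemma greedy_4n_3:
  assumes "5 \<le> n" "run (n + 1) \<le> 3"
  shows "greedy (4 * n + 3) = start (n + 2) - 1 + eps3 n"
proof -
  let ?r = "start (n + 2)"
  have r: "5 \<le> ?r" using start_ge_5 assms by simp
  have v: "greedy ?r = n + 2" "greedy (?r - 1) = n + 1" "greedy (?r - 2) = n + 1 - single (n + 1)"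
    using greedy_start[of "n + 2"] greedy_before_start[of "n + 2"] greedy_two_before_start[of "n + 2"]
      assms by (simp_all add: algebra_simps)
  have m: "greedy ?r \<le> greedy (?r + 1)" "greedy (?r - 3) \<le> greedy (?r - 2)"
    "greedy (?r - 2) \<le> greedy (?r - 3) + 1"
    using greedy_increment[of "?r"] greedy_increment[of "?r - 3"] by simp_all
  have "greedy (?r - 4) \<le> greedy (start (n + 1) - 1)"
    using assms(2) by (intro greedy_mono) (simp add: run_def add.assoc)
  then have m4: "greedy (?r - 4) \<le> n" using greedy_before_start[of "n + 1"] assms(1) by simp
  have s: "start (?r - 1) = greedy (?r - 1) + greedy (?r - 2) + greedy (?r - 3) + greedy (?r - 4)"
    "start ?r = greedy ?r + greedy (?r - 1) + greedy (?r - 2) + greedy (?r - 3)"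
    "start (?r + 1) = greedy (?r + 1) + greedy ?r + greedy (?r - 1) + greedy (?r - 2)"
    by (rule start_shift start_def)+
  show ?thesis
  proof (rule greedy_eqI)
    show "3 \<le> ?r - 1 + eps3 n" using r single_cases[of "n + 1"] by (auto simp: eps3_def)
    show "start (?r - 1 + eps3 n) \<le> 4 * n + 3" "4 * n + 3 < start (?r - 1 + eps3 n + 1)"
      using single_cases[of "n + 1"] s v m m4
      by (auto simp: eps3_def)
  qed
qed

section \<open>Run lengths and the four-adic recurrences\<close>

text \<open>
  The invariant of the recursion \<open>run_4n\<close>. Without the condition on neighbours, \<open>run n = 1\<close> and
  \<open>run (n + 1) = 3\<close> would give \<open>run (4 * n + 2) = 2\<close>, and \<open>4 * n + 2\<close> would not be single like \<open>n\<close>.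
\<close>

definition tame :: "int \<Rightarrow> bool" where
  "tame n \<longleftrightarrow> run n \<le> 3 \<and> \<bar>run n - run (n + 1)\<bar> \<le> 1"

text \<open>
  A run length is a difference of values of \<open>greedy\<close> at distance four. For indices in the same
  class modulo \<open>4\<close>, these are given by the same formula at \<open>n\<close> and \<open>n - 1\<close> (or \<open>n + 1\<close> and \<open>n\<close>).
\<close>

lemma run_4n:
  assumes "6 \<le> n"
  shows "run (4 * n) = run n + eps1 n - eps1 (n - 1)"
    and "run (4 * n + 1) = run n + eps2 n - eps2 (n - 1)"
    and "run n \<le> 3 \<Longrightarrow> run (n + 1) \<le> 3 \<Longrightarrow> run (4 * n + 2) = run (n + 1) + eps3 n - eps3 (n - 1)"
    and "run n \<le> 3 \<Longrightarrow> run (n + 1) \<le> 3 \<Longrightarrow> run (4 * n + 3) = run n + eps0 (n + 1) - eps0 n"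
proof -
  have shift: "4 * n + 1 - 4 = 4 * (n - 1) + 1" "4 * n + 2 - 4 = 4 * (n - 1) + 2"
    "4 * n + 3 - 4 = 4 * (n - 1) + 3" "4 * n + 4 = 4 * (n + 1)" by simp_all
  have r: "run (4 * n) = greedy (4 * n + 1) - greedy (4 * (n - 1) + 1)"
    "run (4 * n + 1) = greedy (4 * n + 2) - greedy (4 * (n - 1) + 2)"
    "run (4 * n + 2) = greedy (4 * n + 3) - greedy (4 * (n - 1) + 3)"
    "run (4 * n + 3) = greedy (4 * (n + 1)) - greedy (4 * n)"
    by (simp_all add: run_eq algebra_simps)
  show "run (4 * n) = run n + eps1 n - eps1 (n - 1)"
    "run (4 * n + 1) = run n + eps2 n - eps2 (n - 1)"
    unfolding r using greedy_4n_1_2[of n] greedy_4n_1_2[of "n - 1"] assms by (simp_all add: run_def)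
  assume "run n \<le> 3" "run (n + 1) \<le> 3"
  then show "run (4 * n + 2) = run (n + 1) + eps3 n - eps3 (n - 1)"
    "run (4 * n + 3) = run n + eps0 (n + 1) - eps0 n"
    unfolding r using greedy_4n_3[of n] greedy_4n_3[of "n - 1"] greedy_4n[of n] greedy_4n[of "n + 1"] assms
    by (simp_all add: run_def algebra_simps)
qed

text \<open>
  Each of the four tameness conditions at \<open>4 m + i\<close> involves only the runs at \<open>m - 1, \<dots>, m + 2\<close>, so
  the induction step is a finite check over their possible lengths.
\<close>

lemma tame_runs: "3 \<le> n \<Longrightarrow> tame n"
proof (induction "nat n" arbitrary: n rule: less_induct)
  case less
  show ?case
  proof (cases "n < 24")
    case True
    then have "n \<in> set [3..23]" unfolding set_upto using less.prems by simp
    then show ?thesis by (auto simp: tame_def run_eq upto_rec_numeral greedy_initial greedy_values)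
  next
    case False
    define m where "m = n div 4"
    have m: "6 \<le> m" "m + 2 < n" using False by (auto simp: m_def)
    have IH: "tame (m - 1)" "tame m" "tame (m + 1)" "tame (m + 2)"
      using less.hyps m by auto
    then have le3: "run (m - 1) \<le> 3" "run m \<le> 3" "run (m + 1) \<le> 3" "run (m + 2) \<le> 3"
      and adj: "\<bar>run (m - 1) - run m\<bar> \<le> 1" "\<bar>run m - run (m + 1)\<bar> \<le> 1"
        "\<bar>run (m + 1) - run (m + 2)\<bar> \<le> 1"
      by (auto simp: tame_def add.assoc)
    have ge1: "1 \<le> run (m - 1)" "1 \<le> run m" "1 \<le> run (m + 1)" "1 \<le> run (m + 2)"
      using run_pos m by auto
    have next4: "run (4 * m + 4) = run (m + 1) + eps1 (m + 1) - eps1 m"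
      using run_4n(1)[of "m + 1"] m by (simp add: algebra_simps)
    note rec = run_4n(1,2)[OF m(1)] run_4n(3,4)[OF m(1) le3(2,3)] next4
    have three: "r = 1 \<or> r = 2 \<or> r = 3" if "1 \<le> r" "r \<le> 3" for r :: int using that by auto
    note cases4 = three[OF ge1(1) le3(1)] three[OF ge1(2) le3(2)] three[OF ge1(3) le3(3)]
      three[OF ge1(4) le3(4)]
    have "n = 4 * m \<or> n = 4 * m + 1 \<or> n = 4 * m + 2 \<or> n = 4 * m + 3"
      unfolding m_def by presburger
    moreover have "tame (4 * m)" "tame (4 * m + 1)" "tame (4 * m + 2)" "tame (4 * m + 3)"
      using cases4 adj rec
      by (elim disjE; simp add: tame_def eps_defs single_def add.assoc)+
    ultimately show ?thesis by auto
  qed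
qed

lemma run_le_3: "3 \<le> n \<Longrightarrow> run n \<le> 3"
  using tame_runs by (simp add: tame_def)

lemma single_4n:
  assumes "6 \<le> m"
  shows "single (4 * m) = (if single m = 1 then single (m + 1) else single (m - 1))"
    and "single (4 * m + 1) = (if single m = 1 then single (m - 1) else single (m + 1))"
    and "single (4 * m + 2) = single m"
    and "single (4 * m + 3) = single (m + 1)"
proof -
  have adj: "\<bar>run (m - 1) - run m\<bar> \<le> 1" "\<bar>run m - run (m + 1)\<bar> \<le> 1"
    using tame_runs[of "m - 1"] tame_runs[of m] assms by (auto simp: tame_def)
  have le3: "run (m - 1) \<le> 3" "run m \<le> 3" "run (m + 1) \<le> 3" using run_le_3 assms by auto
  have ge1: "1 \<le> run (m - 1)" "1 \<le> run m" "1 \<le> run (m + 1)" using run_pos assms by auto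
  note rec = run_4n(1,2)[OF assms] run_4n(3,4)[OF assms le3(2,3)]
  have three: "r = 1 \<or> r = 2 \<or> r = 3" if "1 \<le> r" "r \<le> 3" for r :: int using that by auto
  note cases3 = three[OF ge1(1) le3(1)] three[OF ge1(2) le3(2)] three[OF ge1(3) le3(3)]
  show "single (4 * m) = (if single m = 1 then single (m + 1) else single (m - 1))"
    "single (4 * m + 1) = (if single m = 1 then single (m - 1) else single (m + 1))"
    "single (4 * m + 2) = single m" "single (4 * m + 3) = single (m + 1)"
    using cases3 adj rec
    by (elim disjE; simp add: eps_defs single_def)+
qed

text \<open>
  Three consecutive singles around \<open>4 m, \<dots>, 4 m + 5\<close> would be copied by \<open>single_4n\<close> from three
  consecutive singles around \<open>m\<close>.
\<close>

lemma no_three_singles: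
  "3 \<le> n \<Longrightarrow> single n = 0 \<or> single (n + 1) = 0 \<or> single (n + 2) = 0"
proof (induction "nat n" arbitrary: n rule: less_induct)
  case less
  show ?case
  proof (cases "n < 24")
    case True
    then have "n \<in> set [3..23]" unfolding set_upto using less.prems by simp
    then show ?thesis
      by (auto simp: single_def run_eq upto_rec_numeral greedy_initial greedy_values)
  next
    case False
    define m where "m = n div 4"
    have m: "6 \<le> m" "m + 2 < n" using False by (auto simp: m_def)
    have IH: "single (m - 1) = 0 \<or> single m = 0 \<or> single (m + 1) = 0"
      "single m = 0 \<or> single (m + 1) = 0 \<or> single (m + 2) = 0"
      using less.hyps[of "m - 1"] less.hyps[of m] m by (simp_all add: add.commute)
    have "single (4 * m + 4) = (if single (m + 1) = 1 then single (m + 2) else single m)"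
      "single (4 * m + 5) = (if single (m + 1) = 1 then single m else single (m + 2))"
      using single_4n[of "m + 1"] m by (simp_all add: algebra_simps)
    note rec = single_4n[OF m(1)] this
    have "n = 4 * m \<or> n = 4 * m + 1 \<or> n = 4 * m + 2 \<or> n = 4 * m + 3"
      unfolding m_def by presburger
    then show ?thesis
      using IH rec single_cases[of "m - 1"] single_cases[of m] single_cases[of "m + 1"]
      by (elim disjE) (simp_all add: algebra_simps)
  qed
qed

text \<open>
  Substituting \<open>single_4n\<close> turns each equation into an identity between the bits \<open>single\<close> at
  \<open>m - 1, \<dots>, m + 2\<close>. The identities for \<open>eps1 (4 * m)\<close>, \<open>eps2 (4 * m)\<close>, \<open>eps3 (4 * m)\<close> and
  \<open>eps3 (4 * m + 3)\<close> need \<open>no_three_singles\<close>.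
\<close>

lemma eps_4n:
  assumes m: "6 \<le> m"
  shows "eps0 (4 * m) = (1 - eps0 m) * eps0 (m + 1) + eps0 m * eps0 (m - 1)"
    and "eps0 (4 * m + 1) = (1 - eps0 m) * eps0 (m - 1) + eps0 m * eps0 (m + 1)"
    and "eps0 (4 * m + 2) = eps0 m"
    and "eps0 (4 * m + 3) = eps0 (m + 1)"
    and "eps1 (4 * m) = eps2 m * bit_xor (eps1 (m - 1)) (eps1 (m + 1))"
    and "eps1 (4 * m + 1) = 1 - eps2 m"
    and "eps1 (4 * m + 2) = eps1 m"
    and "eps1 (4 * m + 3) = eps1 (m + 1)"
    and "eps2 (4 * m) = (1 - eps0 (m - 1)) * eps1 (m - 1) + eps0 (m - 1) * (1 - eps1 (m - 1)) * eps2 m"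
    and "eps2 (4 * m + 1) = eps2 (m - 1)"
    and "eps2 (4 * m + 2) = eps2 m"
    and "eps2 (4 * m + 3) = 1 - eps1 m"
    and "eps3 (4 * m) = eps2 (m - 1) * bit_xnor (eps2 m) (eps1 m)"
    and "eps3 (4 * m + 1) = eps3 (m - 1)"
    and "eps3 (4 * m + 2) = eps3 m"
    and "eps3 (4 * m + 3) = (1 - eps1 (m + 1)) * bit_xnor (eps2 m) (eps1 m)"
proof -
  have "single (4 * m + 4) = (if single (m + 1) = 1 then single (m + 2) else single m)"
    using single_4n[of "m + 1"] m by (simp add: algebra_simps)
  note rec = single_4n[OF m] this
  have no3: "single (m - 1) = 0 \<or> single m = 0 \<or> single (m + 1) = 0"
    "single m = 0 \<or> single (m + 1) = 0 \<or> single (m + 2) = 0"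
    using no_three_singles[of "m - 1"] no_three_singles[of m] m by (simp_all add: add.commute)
  note bits = single_cases[of "m - 1"] single_cases[of m] single_cases[of "m + 1"] single_cases[of "m + 2"]
  note defs = eps_defs bit_xor_def bit_xnor_def add.assoc
  show "eps0 (4 * m) = (1 - eps0 m) * eps0 (m + 1) + eps0 m * eps0 (m - 1)"
    "eps0 (4 * m + 1) = (1 - eps0 m) * eps0 (m - 1) + eps0 m * eps0 (m + 1)"
    "eps0 (4 * m + 2) = eps0 m"
    "eps0 (4 * m + 3) = eps0 (m + 1)"
    "eps1 (4 * m) = eps2 m * bit_xor (eps1 (m - 1)) (eps1 (m + 1))"
    "eps1 (4 * m + 1) = 1 - eps2 m"
    "eps1 (4 * m + 2) = eps1 m"
    "eps1 (4 * m + 3) = eps1 (m + 1)"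
    "eps2 (4 * m) = (1 - eps0 (m - 1)) * eps1 (m - 1) + eps0 (m - 1) * (1 - eps1 (m - 1)) * eps2 m"
    "eps2 (4 * m + 1) = eps2 (m - 1)"
    "eps2 (4 * m + 2) = eps2 m"
    "eps2 (4 * m + 3) = 1 - eps1 m"
    "eps3 (4 * m) = eps2 (m - 1) * bit_xnor (eps2 m) (eps1 m)"
    "eps3 (4 * m + 1) = eps3 (m - 1)"
    "eps3 (4 * m + 2) = eps3 m"
    "eps3 (4 * m + 3) = (1 - eps1 (m + 1)) * bit_xnor (eps2 m) (eps1 m)"
    using rec no3 bits by (auto simp: defs)
qed

section \<open>Finitely generated modules over the integers\<close>

lemma int_ideal_principal:
  fixes I :: "int set"
  assumes "0 \<in> I" and diff: "\<And>x y. x \<in> I \<Longrightarrow> y \<in> I \<Longrightarrow> x - y \<in> I"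
    and mult: "\<And>c x. x \<in> I \<Longrightarrow> c * x \<in> I"
  obtains d where "d \<in> I" "\<And>x. x \<in> I \<Longrightarrow> d dvd x"
proof (cases "I = {0}")
  case True
  then show ?thesis using that by auto
next
  case False
  then obtain x where "x \<in> I \<and> x \<noteq> 0" using assms(1) by blast
  from ex_has_least_nat[of "\<lambda>x. x \<in> I \<and> x \<noteq> 0", OF this, of "\<lambda>x. nat \<bar>x\<bar>"]
  obtain d where d: "d \<in> I" "d \<noteq> 0" "\<And>y. y \<in> I \<Longrightarrow> y \<noteq> 0 \<Longrightarrow> nat \<bar>d\<bar> \<le> nat \<bar>y\<bar>" by blast
  have "d dvd y" if y: "y \<in> I" for y
  proof -
    have "y - (y div d) * d \<in> I" using d(1) y diff mult by blast
    then have "y mod d \<in> I" by (simp add: minus_div_mult_eq_mod)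
    moreover have "nat \<bar>y mod d\<bar> < nat \<bar>d\<bar>" using abs_mod_less[OF d(2)] d(2) by simp
    ultimately have "y mod d = 0" using d(3)[of "y mod d"] by linarith
    then show ?thesis by (simp add: dvd_eq_mod_eq_0)
  qed
  then show ?thesis using that d(1) by blast
qed

locale int_module = module scale
  for scale :: "int \<Rightarrow> 'b::ab_group_add \<Rightarrow> 'b"
begin

text \<open>
  The integers are Noetherian. In the step from \<open>H\<close> to \<open>insert x H\<close>, the coefficients of \<open>x\<close> that occur
  in elements of \<open>M\<close> form an ideal; an element of \<open>M\<close> that realises a generator of the ideal, together
  with generators of \<open>M \<inter> span H\<close>, generates \<open>M\<close>.
\<close>

lemma submodule_finitely_generated:
  assumes "finite H" "subspace M" "M \<subseteq> span H"
  shows "\<exists>G. finite G \<and> span G = M"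
  using assms
proof (induction H arbitrary: M rule: finite_induct)
  case empty
  then have "M = {0}" using subspace_0 by auto
  then show ?case using span_empty by blast
next
  case (insert x H)
  define I where "I = {c. \<exists>m\<in>M. m - scale c x \<in> span H}"
  have "0 \<in> I" using subspace_0[OF insert.prems(1)] by (auto simp: I_def intro!: bexI[of _ 0] span_zero)
  moreover have "b - c \<in> I" if "b \<in> I" "c \<in> I" for b c
  proof -
    obtain m n where mn: "m \<in> M" "n \<in> M" "m - scale b x \<in> span H" "n - scale c x \<in> span H"
      using \<open>b \<in> I\<close> \<open>c \<in> I\<close> by (auto simp: I_def)
    have "(m - n) - scale (b - c) x = (m - scale b x) - (n - scale c x)"
      by (simp add: algebra_simps)
    then have "(m - n) - scale (b - c) x \<in> span H" using mn span_diff by metis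
    then show ?thesis using mn subspace_diff[OF insert.prems(1)] by (auto simp: I_def)
  qed
  moreover have "b * c \<in> I" if "c \<in> I" for b c
  proof -
    obtain m where m: "m \<in> M" "m - scale c x \<in> span H" using \<open>c \<in> I\<close> by (auto simp: I_def)
    have "scale b m - scale (b * c) x = scale b (m - scale c x)" by (simp add: algebra_simps)
    then have "scale b m - scale (b * c) x \<in> span H" using m span_scale by metis
    then show ?thesis using m subspace_scale[OF insert.prems(1)] by (auto simp: I_def)
  qed
  ultimately obtain d where d: "d \<in> I" "\<And>c. c \<in> I \<Longrightarrow> d dvd c"
    using int_ideal_principal[of I] by metis
  obtain m0 where m0: "m0 \<in> M" "m0 - scale d x \<in> span H" using d(1) by (auto simp: I_def)
  have "subspace (M \<inter> span H)" using insert.prems(1) by (intro subspace_inter subspace_span)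
  then obtain G where G: "finite G" "span G = M \<inter> span H"
    using insert.IH[of "M \<inter> span H"] by auto
  have "span (insert m0 G) = M"
  proof (rule span_subspace[OF _ _ insert.prems(1)])
    show "insert m0 G \<subseteq> M" using m0(1) G(2) span_superset[of G] by auto
    show "M \<subseteq> span (insert m0 G)"
    proof
      fix m assume m: "m \<in> M"
      then obtain c where c: "m - scale c x \<in> span H"
        using insert.prems(2) span_breakdown_eq by blast
      then have "c \<in> I" using m by (auto simp: I_def)
      then obtain q where q: "c = d * q" using d(2) by blast
      have "m - scale q m0 = (m - scale c x) - scale q (m0 - scale d x)"
        by (simp add: q algebra_simps)
      then have "m - scale q m0 \<in> span H" using c m0(2) span_diff span_scale by metis
      moreover have "m - scale q m0 \<in> M"
        using m m0(1) insert.prems(1) subspace_diff subspace_scale by metis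
      ultimately show "m \<in> span (insert m0 G)" using G(2) span_breakdown_eq by blast
    qed
  qed
  then show ?case using G(1) by blast
qed

end

section \<open>Automatic and regular sequences from a finite state\<close>

text \<open>
  A state sequence that a finite automaton reading base-\<open>k\<close> digits computes from the threshold \<open>N\<close> on:
  the state at \<open>k n + j\<close> is a function of \<open>j\<close> and the state at \<open>n\<close>. The function itself stays
  implicit, so that the state may be any convenient local datum.
\<close>

locale eventually_automatic_state =
  fixes k N :: nat and W :: "nat \<Rightarrow> 'w"
  assumes k_pos: "0 < k"
    and finite_states: "finite (range W)"
    and state_step: "\<And>n n' j. N \<le> n \<Longrightarrow> N \<le> n' \<Longrightarrow> W n = W n' \<Longrightarrow> j < k \<Longrightarrow>
      W (k * n + j) = W (k * n' + j)"
begin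

definition determined :: "(nat \<Rightarrow> 'a) \<Rightarrow> bool" where
  "determined f \<longleftrightarrow> (\<forall>n\<ge>N. \<forall>n'\<ge>N. W n = W n' \<longrightarrow> f n = f n')"

lemma power_index_split: "k ^ Suc i * n + j = k * (k ^ i * n + j div k) + j mod k"
  by (simp add: algebra_simps)

lemma power_index_ge: "N \<le> n \<Longrightarrow> N \<le> k ^ i * n + j"
  using k_pos by (intro trans_le_add1 order.trans[OF _ mult_le_mono1[of 1 "k ^ i" n]]) auto

lemma state_power:
  assumes "N \<le> n" "N \<le> n'" "W n = W n'" "j < k ^ i"
  shows "W (k ^ i * n + j) = W (k ^ i * n' + j)"
  using assms(4)
proof (induction i arbitrary: j)
  case 0
  then show ?case using assms by simp
next
  case (Suc i)
  have "j div k < k ^ i" using Suc.prems k_pos by (simp add: less_mult_imp_div_less mult.commute)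
  then have "W (k ^ i * n + j div k) = W (k ^ i * n' + j div k)" by (rule Suc.IH)
  then show ?case
    unfolding power_index_split
    using assms k_pos by (intro state_step power_index_ge) auto
qed

text \<open>
  A retraction onto finitely many indices. Below the threshold the indices stay separate,
  so every sequence determined by the state factors through \<open>rep\<close> on all of the natural numbers.
\<close>

definition rep :: "nat \<Rightarrow> nat" where
  "rep n = (if n < N then n else SOME m. N \<le> m \<and> W m = W n)"

lemma rep_state: "N \<le> n \<Longrightarrow> N \<le> rep n \<and> W (rep n) = W n"
  unfolding rep_def using someI[of "\<lambda>m. N \<le> m \<and> W m = W n" n] by simp

lemma determined_rep: "determined f \<Longrightarrow> f (rep n) = f n"
  using rep_state[of n] by (cases "n < N") (auto simp: determined_def rep_def)

lemma finite_range_rep: "finite (range rep)"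
proof (rule finite_subset)
  show "range rep \<subseteq> {..<N} \<union> (\<lambda>w. SOME m. N \<le> m \<and> W m = w) ` range W"
    by (auto simp: rep_def)
qed (use finite_states in simp)

text \<open>
  Every kernel sequence is again determined by the state, hence by its restriction to the finite
  set \<open>range rep\<close>, and there are only finitely many functions from that set to the values of \<open>f\<close>.
\<close>

theorem determined_imp_automatic:
  assumes fin: "finite (range f)" and f: "\<And>n n'. N \<le> n \<Longrightarrow> N \<le> n' \<Longrightarrow> W n = W n' \<Longrightarrow> f n = f n'"
  shows "automatic_seq k f"
  unfolding automatic_seq_def
proof
  let ?P = "range rep \<rightarrow>\<^sub>E range f"
  have "kernel_seqs k f \<subseteq> (\<lambda>h n. h (rep n)) ` ?P"
  proof
    fix g assume "g \<in> kernel_seqs k f"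
    then obtain i j where ij: "j < k ^ i" "g = (\<lambda>n. f (k ^ i * n + j))" by (auto simp: kernel_seqs_def)
    have "determined g"
      unfolding determined_def ij(2) by (intro allI impI f power_index_ge state_power ij(1))
    then have "g = (\<lambda>n. restrict g (range rep) (rep n))" by (simp add: determined_rep)
    moreover have "restrict g (range rep) \<in> ?P" using ij(2) by auto
    ultimately show "g \<in> (\<lambda>h n. h (rep n)) ` ?P" by (rule image_eqI)
  qed
  then show "finite (kernel_seqs k f)"
    by (rule finite_subset) (intro finite_imageI finite_PiE finite_range_rep fin)
qed (rule fin)

lemma determined_in_span:
  fixes h :: "nat \<Rightarrow> int"
  assumes "determined h"
  shows "h \<in> int_seq.span ((\<lambda>x n. of_bool (rep n = x)) ` range rep)"
proof -
  have sum_app: "(\<Sum>x\<in>R. F x) n = (\<Sum>x\<in>R. F x n)" if "finite R" for R n and F :: "nat \<Rightarrow> nat \<Rightarrow> int"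
    using that by (induction R rule: finite_induct) auto
  let ?ind = "\<lambda>x n. of_bool (rep n = x) :: int"
  have "h = (\<Sum>x\<in>range rep. (\<lambda>n. h x * of_bool (rep n = x)))"
    by (rule ext) (simp add: sum_app finite_range_rep determined_rep[OF assms] if_distrib
        of_bool_def sum.delta cong: if_cong)
  also have "\<dots> \<in> int_seq.span (?ind ` range rep)"
    by (intro int_seq.span_sum int_seq.span_scale[of "?ind _"] int_seq.span_base imageI)
  finally show ?thesis .
qed

text \<open>
  Iterating the hypothesis, the kernel sequence \<open>n \<mapsto> a (k ^ i * n + j)\<close> is \<open>c ^ i\<close> times \<open>a\<close> plus a
  sequence determined by the state. So the kernel lies in the module generated by \<open>a\<close> and
  the indicator functions of the fibres of \<open>rep\<close>.
\<close>

theorem regular_if_determined_defect: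
  fixes a :: "nat \<Rightarrow> int"
  assumes defect: "\<And>n n' j. N \<le> n \<Longrightarrow> N \<le> n' \<Longrightarrow> W n = W n' \<Longrightarrow> j < k \<Longrightarrow>
    a (k * n + j) - c * a n = a (k * n' + j) - c * a n'"
  shows "regular_seq k a"
proof -
  have defect_power: "a (k ^ i * n + j) - c ^ i * a n = a (k ^ i * n' + j) - c ^ i * a n'"
    if n: "N \<le> n" "N \<le> n'" "W n = W n'" and j: "j < k ^ i" for n n' i j
    using j
  proof (induction i arbitrary: j)
    case (Suc i)
    let ?p = "k ^ i * n + j div k" and ?p' = "k ^ i * n' + j div k"
    have jd: "j div k < k ^ i" using Suc.prems k_pos by (simp add: less_mult_imp_div_less mult.commute)
    have "a (k * ?p + j mod k) - c * a ?p = a (k * ?p' + j mod k) - c * a ?p'"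
      using n jd k_pos by (intro defect power_index_ge state_power) auto
    moreover have "c * (a ?p - c ^ i * a n) = c * (a ?p' - c ^ i * a n')" using Suc.IH[OF jd] by simp
    ultimately show ?case unfolding power_index_split by (simp add: algebra_simps)
  qed simp
  define H where "H = insert a ((\<lambda>x n. of_bool (rep n = x)) ` range rep)"
  have "g \<in> int_seq.span H" if "g \<in> kernel_seqs k a" for g
  proof -
    obtain i j where ij: "j < k ^ i" "g = (\<lambda>n. a (k ^ i * n + j))"
      using \<open>g \<in> kernel_seqs k a\<close> by (auto simp: kernel_seqs_def)
    define h where "h = (\<lambda>n. a (k ^ i * n + j) - c ^ i * a n)"
    have "determined h" unfolding determined_def h_def using defect_power ij(1) by blast
    then have "h \<in> int_seq.span H"
      unfolding H_def by (rule subsetD[OF int_seq.span_mono determined_in_span, rotated]) auto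
    moreover have "(\<lambda>n. c ^ i * a n) \<in> int_seq.span H"
      by (intro int_seq.span_scale int_seq.span_base) (simp add: H_def)
    ultimately have "h + (\<lambda>n. c ^ i * a n) \<in> int_seq.span H" by (rule int_seq.span_add)
    then show ?thesis by (simp add: ij(2) h_def plus_fun_def)
  qed
  then have "int_seq.span (kernel_seqs k a) \<subseteq> int_seq.span H"
    by (intro int_seq.span_minimal int_seq.subspace_span) blast
  moreover have "finite H" by (simp add: H_def finite_range_rep)
  ultimately show ?thesis
    unfolding regular_seq_def
    using int_module.submodule_finitely_generated[OF int_module.intro[OF int_seq.module_axioms]
        _ int_seq.subspace_span] by blast
qed

end

section \<open>The local profile of the sequence\<close>

text \<open>
  The range \<open>-4 \<le> t \<le> 3\<close> is closed under the recursion: the values at \<open>4 n + j + t\<close>, where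
  \<open>j + t\<close> lies between \<open>-4\<close> and \<open>6\<close>, come from the blocks of \<open>n - 1\<close>, \<open>n\<close> and \<open>n + 1\<close>, and these involve the
  terms at \<open>n - 4, \<dots>, n + 3\<close>.
\<close>

definition profile :: "nat \<Rightarrow> int list" where
  "profile n = map (\<lambda>t. greedy (int n + t) - greedy (int n)) [-4..3]"

lemma profile_eq_iff:
  "profile n = profile n' \<longleftrightarrow>
     (\<forall>t\<in>{-4..3}. greedy (int n + t) - greedy (int n) = greedy (int n' + t) - greedy (int n'))"
  by (simp only: profile_def map_eq_conv set_upto)

lemma finite_range_profile: "finite (range profile)"
proof (rule finite_subset)
  have "greedy (int n + t) - greedy (int n) \<in> {-4..3}" if "t \<in> {-4..3}" for n t
    using that greedy_add[of t "int n"] greedy_add[of "-t" "int n + t"]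
    by (cases "0 \<le> t") auto
  then have "set (profile n) \<subseteq> {-4..3}" for n
    unfolding profile_def set_map set_upto by blast
  moreover have "length (profile n) = 8" for n by (simp add: profile_def)
  ultimately show "range profile \<subseteq> {xs. set xs \<subseteq> {-4..3} \<and> length xs = 8}" by blast
qed (rule finite_lists_length_eq, simp)

lemma single_profile:
  assumes "profile n = profile n'" "t \<in> {-1..2}"
  shows "single (int n + t) = single (int n' + t)"
proof -
  have "t + 1 \<in> {-4..3}" "t - 3 \<in> {-4..3}" using assms(2) by auto
  then have "greedy (int n + (t + 1)) - greedy (int n) = greedy (int n' + (t + 1)) - greedy (int n')"
    "greedy (int n + (t - 3)) - greedy (int n) = greedy (int n' + (t - 3)) - greedy (int n')"
    using assms(1) unfolding profile_eq_iff by blast+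
  then have "run (int n + t) = run (int n' + t)" by (simp add: run_eq algebra_simps)
  then show ?thesis by (simp add: single_def)
qed

text \<open>
  The value at \<open>4 n + t\<close> is a sum of four terms near \<open>n\<close> and a correction; relative to \<open>4 a n\<close> both
  are functions of the profile.
\<close>

lemma greedy_4n_profile:
  assumes n: "6 \<le> n" "6 \<le> n'" and eq: "profile n = profile n'" and t: "t \<in> {-4..6}"
  shows "greedy (4 * int n + t) - 4 * greedy (int n) = greedy (4 * int n' + t) - 4 * greedy (int n')"
proof -
  have blocks: "greedy (4 * m) = start m + 1 + eps0 m" "greedy (4 * m + 1) = start (m + 1) + eps1 m"
    "greedy (4 * m + 2) = start (m + 1) + eps2 m" "greedy (4 * m + 3) = start (m + 2) - 1 + eps3 m"
    if "5 \<le> m" for m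
    using that greedy_4n greedy_4n_1_2 greedy_4n_3 run_le_3 by auto
  have start: "start (int n + s) - 4 * greedy (int n) = start (int n' + s) - 4 * greedy (int n')"
    if "s \<in> {-1..3}" for s
  proof -
    have "s \<in> {-4..3}" "s - 1 \<in> {-4..3}" "s - 2 \<in> {-4..3}" "s - 3 \<in> {-4..3}" using that by auto
    then have "greedy (int n + s) - greedy (int n) = greedy (int n' + s) - greedy (int n')"
      "greedy (int n + (s - 1)) - greedy (int n) = greedy (int n' + (s - 1)) - greedy (int n')"
      "greedy (int n + (s - 2)) - greedy (int n) = greedy (int n' + (s - 2)) - greedy (int n')"
      "greedy (int n + (s - 3)) - greedy (int n) = greedy (int n' + (s - 3)) - greedy (int n')"
      using eq unfolding profile_eq_iff by blast+
    then show ?thesis by (simp add: start_def algebra_simps)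
  qed
  have eps: "eps0 (int n + s) = eps0 (int n' + s)" "eps1 (int n + s) = eps1 (int n' + s)"
    "eps2 (int n + s) = eps2 (int n' + s)" "eps3 (int n + s) = eps3 (int n' + s)"
    if "s \<in> {-1..1}" for s
    using single_profile[OF eq, of s] single_profile[OF eq, of "s + 1"] that
    by (auto simp: eps_defs add.assoc)
  \<comment> \<open>The index \<open>4 n + t\<close> lies in the block of \<open>n + s\<close>.\<close>
  define s where "s = t div 4"
  have s: "s \<in> {-1..1}" "t - 4 * s \<in> {0..3}" using t by (auto simp: s_def)
  have split: "greedy (4 * x + t) = greedy (4 * (x + s) + (t - 4 * s))" for x
    by (simp add: algebra_simps)
  have "5 \<le> int n + s" "5 \<le> int n' + s" using n s by auto
  note b = blocks[OF this(1)] blocks[OF this(2)]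
  have "t - 4 * s = 0 \<or> t - 4 * s = 1 \<or> t - 4 * s = 2 \<or> t - 4 * s = 3" using s(2) by auto
  then show ?thesis
    unfolding split
    using b eps[OF s(1)] start[of s] start[of "s + 1"] start[of "s + 2"] s(1)
    by (elim disjE) (simp_all add: add.assoc)
qed

interpretation golomb: eventually_automatic_state 4 6 profile
proof
  fix n n' j :: nat
  assume A: "6 \<le> n" "6 \<le> n'" "profile n = profile n'" "j < 4"
  have "greedy (int (4 * n + j) + t) - greedy (int (4 * n + j))
      = greedy (int (4 * n' + j) + t) - greedy (int (4 * n' + j))" if "t \<in> {-4..3}" for t
    using greedy_4n_profile[OF A(1-3), of "int j + t"] greedy_4n_profile[OF A(1-3), of "int j"] that A(4)
    by (simp add: add.assoc)
  then show "profile (4 * n + j) = profile (4 * n' + j)" by (simp add: profile_eq_iff)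
qed (simp_all add: finite_range_profile)

lemma eps_automatic:
  "automatic_seq 4 (\<lambda>n. eps0 (int n))" "automatic_seq 4 (\<lambda>n. eps1 (int n))"
  "automatic_seq 4 (\<lambda>n. eps2 (int n))" "automatic_seq 4 (\<lambda>n. eps3 (int n))"
proof -
  have bits: "eps0 m \<in> {0, 1}" "eps1 m \<in> {0, 1}" "eps2 m \<in> {0, 1}" "eps3 m \<in> {0, 1}" for m
    using single_cases[of m] single_cases[of "m + 1"] by (auto simp: eps_defs)
  have automatic: "automatic_seq 4 (\<lambda>n. f (int n))"
    if f: "\<And>m. f m \<in> {0, 1}" "\<And>n n'. profile n = profile n' \<Longrightarrow> f (int n) = f (int n')"
    for f :: "int \<Rightarrow> int"
  proof (rule golomb.determined_imp_automatic)
    show "finite (range (\<lambda>n. f (int n)))" by (rule finite_subset[of _ "{0, 1}"]) (use f(1) in auto)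
  qed (rule f(2))
  have single_eq: "single (int n) = single (int n')" "single (int n + 1) = single (int n' + 1)"
    if "profile n = profile n'" for n n'
    using single_profile[OF that, of 0] single_profile[OF that, of 1] by simp_all
  have "eps0 (int n) = eps0 (int n')" "eps1 (int n) = eps1 (int n')"
    "eps2 (int n) = eps2 (int n')" "eps3 (int n) = eps3 (int n')"
    if "profile n = profile n'" for n n'
    by (simp_all only: eps_defs single_eq[OF that])
  with bits show "automatic_seq 4 (\<lambda>n. eps0 (int n))" "automatic_seq 4 (\<lambda>n. eps1 (int n))"
    "automatic_seq 4 (\<lambda>n. eps2 (int n))" "automatic_seq 4 (\<lambda>n. eps3 (int n))"
    by (blast intro: automatic)+
qed

lemma greedy_regular: "regular_seq 4 (\<lambda>n. greedy (int n))"
proof (rule golomb.regular_if_determined_defect[where c = 4])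
  fix n n' j :: nat
  assume "6 \<le> n" "6 \<le> n'" "profile n = profile n'" "j < 4"
  then show "greedy (int (4 * n + j)) - 4 * greedy (int n) = greedy (int (4 * n' + j)) - 4 * greedy (int n')"
    using greedy_4n_profile[of n n' "int j"] by simp
qed

section \<open>The four-adic structure of the almost Golomb sequence\<close>

theorem theorem5p1:
  fixes a :: "int \<Rightarrow> int"
  assumes "a = almost_golomb4"
  shows "(\<exists>\<epsilon>\<^sub>0 \<epsilon>\<^sub>1 \<epsilon>\<^sub>2 \<epsilon>\<^sub>3 :: nat \<Rightarrow> int.
    (\<forall>n\<ge>5.
      \<epsilon>\<^sub>0 n \<in> {0, 1} \<and> \<epsilon>\<^sub>1 n \<in> {0, 1} \<and> \<epsilon>\<^sub>2 n \<in> {0, 1} \<and> \<epsilon>\<^sub>3 n \<in> {0, 1} \<and>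
      a (4 * int n) = a (int n - 3) + a (int n - 2) + a (int n - 1) + a (int n) + 1 + \<epsilon>\<^sub>0 n \<and>
      a (4 * int n + 1) = a (int n - 2) + a (int n - 1) + a (int n) + a (int n + 1) + \<epsilon>\<^sub>1 n \<and>
      a (4 * int n + 2) = a (int n - 2) + a (int n - 1) + a (int n) + a (int n + 1) + \<epsilon>\<^sub>2 n \<and>
      a (4 * int n + 3) = a (int n - 1) + a (int n) + a (int n + 1) + a (int n + 2) - 1 + \<epsilon>\<^sub>3 n) \<and>
    (\<forall>m\<ge>6.
      \<epsilon>\<^sub>0 (4 * m) = (1 - \<epsilon>\<^sub>0 m) * \<epsilon>\<^sub>0 (m + 1) + \<epsilon>\<^sub>0 m * \<epsilon>\<^sub>0 (m - 1) \<and>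
      \<epsilon>\<^sub>0 (4 * m + 1) = (1 - \<epsilon>\<^sub>0 m) * \<epsilon>\<^sub>0 (m - 1) + \<epsilon>\<^sub>0 m * \<epsilon>\<^sub>0 (m + 1) \<and>
      \<epsilon>\<^sub>0 (4 * m + 2) = \<epsilon>\<^sub>0 m \<and>
      \<epsilon>\<^sub>0 (4 * m + 3) = \<epsilon>\<^sub>0 (m + 1) \<and>
      \<epsilon>\<^sub>1 (4 * m) = \<epsilon>\<^sub>2 m * bit_xor (\<epsilon>\<^sub>1 (m - 1)) (\<epsilon>\<^sub>1 (m + 1)) \<and>
      \<epsilon>\<^sub>1 (4 * m + 1) = 1 - \<epsilon>\<^sub>2 m \<and>
      \<epsilon>\<^sub>1 (4 * m + 2) = \<epsilon>\<^sub>1 m \<and>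
      \<epsilon>\<^sub>1 (4 * m + 3) = \<epsilon>\<^sub>1 (m + 1) \<and>
      \<epsilon>\<^sub>2 (4 * m) = (1 - \<epsilon>\<^sub>0 (m - 1)) * \<epsilon>\<^sub>1 (m - 1)
                  + \<epsilon>\<^sub>0 (m - 1) * (1 - \<epsilon>\<^sub>1 (m - 1)) * \<epsilon>\<^sub>2 m \<and>
      \<epsilon>\<^sub>2 (4 * m + 1) = \<epsilon>\<^sub>2 (m - 1) \<and>
      \<epsilon>\<^sub>2 (4 * m + 2) = \<epsilon>\<^sub>2 m \<and>
      \<epsilon>\<^sub>2 (4 * m + 3) = 1 - \<epsilon>\<^sub>1 m \<and>
      \<epsilon>\<^sub>3 (4 * m) = \<epsilon>\<^sub>2 (m - 1) * bit_xnor (\<epsilon>\<^sub>2 m) (\<epsilon>\<^sub>1 m) \<and>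
      \<epsilon>\<^sub>3 (4 * m + 1) = \<epsilon>\<^sub>3 (m - 1) \<and>
      \<epsilon>\<^sub>3 (4 * m + 2) = \<epsilon>\<^sub>3 m \<and>
      \<epsilon>\<^sub>3 (4 * m + 3) = (1 - \<epsilon>\<^sub>1 (m + 1)) * bit_xnor (\<epsilon>\<^sub>2 m) (\<epsilon>\<^sub>1 m)) \<and>
    automatic_seq 4 \<epsilon>\<^sub>0 \<and> automatic_seq 4 \<epsilon>\<^sub>1 \<and> automatic_seq 4 \<epsilon>\<^sub>2 \<and> automatic_seq 4 \<epsilon>\<^sub>3) \<and>
    regular_seq 4 (\<lambda>n. a (int n))"
proof -
  have a: "a = greedy" using assms almost_golomb4_eq_greedy by simp
  have block_values:
    "greedy (4 * int n) = greedy (int n - 3) + greedy (int n - 2) + greedy (int n - 1) + greedy (int n) + 1 + eps0 (int n)"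
    "greedy (4 * int n + 1) = greedy (int n - 2) + greedy (int n - 1) + greedy (int n) + greedy (int n + 1) + eps1 (int n)"
    "greedy (4 * int n + 2) = greedy (int n - 2) + greedy (int n - 1) + greedy (int n) + greedy (int n + 1) + eps2 (int n)"
    "greedy (4 * int n + 3) = greedy (int n - 1) + greedy (int n) + greedy (int n + 1) + greedy (int n + 2) - 1 + eps3 (int n)"
    if "5 \<le> n" for n
    using greedy_4n[of "int n"] greedy_4n_1_2[of "int n"] greedy_4n_3[of "int n"] run_le_3 that
    by (simp_all add: start_shift start_def[of "int n"])
  have bits: "eps0 m \<in> {0, 1}" "eps1 m \<in> {0, 1}" "eps2 m \<in> {0, 1}" "eps3 m \<in> {0, 1}" for m
    using single_cases[of m] single_cases[of "m + 1"] by (auto simp: eps_defs)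
  have index: "int (4 * m) = 4 * int m" "int (4 * m + 1) = 4 * int m + 1"
    "int (4 * m + 2) = 4 * int m + 2" "int (4 * m + 3) = 4 * int m + 3"
    "int (m + 1) = int m + 1" "int (m - 1) = int m - 1" if "6 \<le> m" for m :: nat
    using that by auto
  show ?thesis
    unfolding a
    by (rule conjI[OF _ greedy_regular], rule exI[of _ "\<lambda>n. eps0 (int n)"],
        rule exI[of _ "\<lambda>n. eps1 (int n)"], rule exI[of _ "\<lambda>n. eps2 (int n)"],
        rule exI[of _ "\<lambda>n. eps3 (int n)"], intro conjI allI impI eps_automatic)
      (rule bits | rule block_values, assumption | simp only: index, rule eps_4n, simp)+
qed

end
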